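(* Let $p$ be a prime and let $q$ be a prime with $q^2\mid 2^p-1$. Let $w\ge 2$ be an integer. Then $q^w$ exactly divides $2^p-1$ (i.e. $q^w\mid 2^p-1$ and $q^{w+1}\nmid 2^p-1$) if and only if $q$ is a Wieferich prime of order $w-1$.
   Context: A prime $q$ is a Wieferich prime of order $v\ge1$ if $q^{v+1}$ exactly divides $2^{q-1}-1$, i.e. $q^{v+1}\mid 2^{q-1}-1$ and $q^{v+2}\nmid 2^{q-1}-1$. *)

theory Defs
  imports "HOL-Computational_Algebra.Primes"
begin

definition exactly_divides :: "nat \<Rightarrow> nat \<Rightarrow> nat \<Rightarrow> bool" where
  "exactly_divides q k n \<longleftrightarrow> q ^ k dvd n \<and> \<not> q ^ (k + 1) dvd n"

(* The subtractions on nat do not truncate: q > 0 and 2 ^ (q - 1) \<ge> 1. *)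
definition wieferich_prime_of_order :: "nat \<Rightarrow> nat \<Rightarrow> bool" where
  "wieferich_prime_of_order v q \<longleftrightarrow>
     prime q \<and> v \<ge> 1 \<and> exactly_divides q (v + 1) (2 ^ (q - 1) - 1)"

end

theory Submission
  imports Defs "HOL-Number_Theory.Pocklington"
begin

text \<open>
  Since \<open>q\<close> divides \<open>2^p - 1\<close>, the order of \<open>2\<close> modulo \<open>q\<close> is \<open>p\<close>, so \<open>q - 1 = p m\<close> by Fermat.
  With \<open>a = 2^p \<equiv> 1\<close> modulo \<open>q\<close>, the cofactor in
  \<open>2^(q-1) - 1 = (a - 1) (1 + a + \<dots> + a^(m-1))\<close> is congruent to \<open>m\<close>, hence prime to \<open>q\<close>.
  So the same powers of \<open>q\<close> divide \<open>2^p - 1\<close> and \<open>2^(q-1) - 1\<close>.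
\<close>

lemma power_diff_1_nat:
  fixes a m :: nat
  assumes "a \<ge> 1"
  shows "a ^ m - 1 = (a - 1) * (\<Sum>i<m. a ^ i)"
proof -
  \<comment> \<open>The factorization is taken from the integers; \<open>a \<ge> 1\<close> keeps
    both subtractions exact.\<close>
  have "int (a ^ m - 1) = int ((a - 1) * (\<Sum>i<m. a ^ i))"
    using assms power_diff_1_eq[of "int a" m] by (simp add: of_nat_diff)
  then show ?thesis
    by (simp only: of_nat_eq_iff)
qed

lemma cong_1_geometric_sum:
  fixes a m q :: nat
  assumes "[a = 1] (mod q)"
  shows "[(\<Sum>i<m. a ^ i) = m] (mod q)"
proof -
  have "[a ^ i = 1] (mod q)" for i
    using cong_pow[OF assms, of i] by simp
  then have "[(\<Sum>i<m. a ^ i) = (\<Sum>i<m. 1)] (mod q)"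
    by (intro cong_sum)
  then show ?thesis
    by simp
qed

lemma prime_power_dvd_power_diff_1_iff:
  fixes a k m q :: nat
  assumes "prime q" and "a \<ge> 1" and "[a = 1] (mod q)" and "\<not> q dvd m"
  shows "q ^ k dvd a ^ m - 1 \<longleftrightarrow> q ^ k dvd a - 1"
proof -
  have "\<not> q dvd (\<Sum>i<m. a ^ i)"
    using cong_dvd_iff[OF cong_1_geometric_sum[OF assms(3), of m]] assms(4) by simp
  then have "coprime (q ^ k) (\<Sum>i<m. a ^ i)"
    using assms(1) by (simp add: prime_imp_coprime)
  then show ?thesis
    using power_diff_1_nat[OF assms(2), of m] by (simp add: coprime_dvd_mult_left_iff)
qed

text \<open>The order of \<open>2\<close> modulo \<open>q\<close> divides the prime \<open>p\<close>
  and is not \<open>1\<close>, so it is \<open>p\<close>; by Fermat it divides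
  \<open>q - 1\<close>.\<close>

lemma prime_divisor_mersenne:
  fixes p q :: nat
  assumes "prime p" and "prime q" and "q dvd 2 ^ p - 1"
  shows "p dvd q - 1"
proof -
  have cong: "[2 ^ p = 1] (mod q)"
    using assms(3) by (simp add: cong_altdef_nat)
  have "\<not> q dvd 2"
  proof
    assume "q dvd 2"
    then have "q dvd 2 ^ p"
      using prime_gt_0_nat[OF assms(1)] by (blast intro: dvd_trans dvd_power)
    then have "q dvd 1"
      using cong_dvd_iff[OF cong] by blast
    then show False
      using assms(2) by simp
  qed
  then have fermat: "[2 ^ (q - 1) = 1] (mod q)"
    using assms(2) fermat_theorem by blast
  have "ord q 2 \<noteq> 1"
  proof
    assume "ord q 2 = 1"
    then have "[2 = 1] (mod q)"
      using ord_works[of 2 q] by simp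
    then have "q dvd 1"
      by (simp add: cong_altdef_nat)
    then show False
      using assms(2) by simp
  qed
  moreover have "ord q 2 dvd p"
    using cong by (simp only: ord_divides)
  ultimately have "ord q 2 = p"
    using assms(1) by (auto simp: prime_nat_iff)
  then show ?thesis
    using fermat by (simp only: ord_divides)
qed

theorem theorem6:
  fixes p q w :: nat
  assumes "prime p"
    and "prime q"
    and "q ^ 2 dvd 2 ^ p - 1"
    and "w \<ge> 2"
  shows "exactly_divides q w (2 ^ p - 1) \<longleftrightarrow> wieferich_prime_of_order (w - 1) q"
proof -
  have dvd: "q dvd 2 ^ p - 1"
    using assms(3) by (auto simp: power2_eq_square intro: dvd_mult_left)
  then obtain m where m: "q - 1 = p * m"
    using prime_divisor_mersenne assms(1,2) by (meson dvdE)
  have "q > 1"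
    using assms(2) by (rule prime_gt_1_nat)
  \<comment> \<open>The bounds \<open>0 < m < q\<close> rule out \<open>q dvd m\<close>.\<close>
  have "m > 0"
    using m \<open>q > 1\<close> by (cases m) auto
  have "m \<le> q - 1"
    using m prime_gt_0_nat[OF assms(1)] by simp
  then have "\<not> q dvd m"
    using \<open>q > 1\<close> \<open>m > 0\<close> by (auto dest: dvd_imp_le)
  then have same_powers: "q ^ k dvd 2 ^ (q - 1) - 1 \<longleftrightarrow> q ^ k dvd 2 ^ p - 1" for k
    \<comment> \<open>This turns \<open>2 ^ (q - 1)\<close> into \<open>(2 ^ p) ^ m\<close>, so
      \<open>a = 2 ^ p\<close> fits.\<close>
    unfolding m power_mult
    using dvd assms(2) by (intro prime_power_dvd_power_diff_1_iff) (simp_all add: cong_altdef_nat)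
  \<comment> \<open>Order \<open>w - 1\<close> means exponent \<open>w\<close>;
    \<open>w \<ge> 2\<close> makes this order positive.\<close>
  have "w - 1 + 1 = w" and "w - 1 \<ge> 1"
    using assms(4) by simp_all
  then show ?thesis
    using assms(2) unfolding wieferich_prime_of_order_def exactly_divides_def
    by (simp only: same_powers simp_thms)
qed

end
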